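(* Let $M$ be a compact manifold, let $f:M\to M$ be an expansive diffeomorphism, and let $\phi$ be a singular suspension of $f$. Then $$\limsup_{T\to\infty}\frac1T\log\nu(T)\le e(\phi),$$ where $\nu(T)$ is the number of distinct periodic orbits of $\phi$ with period in $[0,T]$ and $e(\phi)=h_{\mathrm{top}}(\phi_1)$ is the topological entropy of the time-one map of $\phi$.
   Context: A homeomorphism $f:M\to M$ is expansive if there is $c>0$ such that $d(f^n(x),f^n(y))<c$ for every $n\in\mathbb Z$ implies $x=y$. Singular suspension. The suspension manifold of a diffeomorphism $f:M\to M$ is $M_f=(M\times[0,1])/\!\sim$, where $(x,1)\sim(f(x),0)$ for every $x\in M$; $[x,r]$ denotes the class of $(x,r)$. The ordinary suspension flow is $\psi_t([x,r])=[x,r+t]$ (the equivalence relation being used when the second coordinate crosses $0$ or $1$), and $V$ is the smooth nonsingular vector field on $M_f$ generating $\psi$. Fix a point $\sigma=[a,r_0]\in M_f$ with $a\in M$, $0<r_0<1$, and a smooth function $\alpha:M_f\to[0,\infty)$ (a brake function) with $\alpha^{-1}(0)=\{\sigma\}$. The flow $\phi$ generated by the (complete) vector field $W=\alpha V$ is called a singular suspension of $f$; its only singularity is $\sigma$. A point $x$ is periodic for $\phi$ if there is a minimal $\pi(x)>0$ (its period) with $\phi_{\pi(x)}(x)=x$; a periodic orbit is the orbit of a periodic point, and its period is that of the point (singularities are not periodic points). Convention: $\log 0=-\infty$. *)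

theory Defs
  imports "HOL-Analysis.Analysis"
begin

section \<open>Smooth manifolds\<close>

text \<open>\<open>C_on k S g\<close> says that \<open>g\<close> is of class \<open>C\<^sup>k\<close> on \<open>S\<close>. It is only meant for open sets
  \<open>S\<close> of a finite-dimensional space, where continuity of all directional derivatives is
  continuity of the derivative.\<close>

fun C_on :: "nat \<Rightarrow> 'a::real_normed_vector set \<Rightarrow> ('a \<Rightarrow> 'b::real_normed_vector) \<Rightarrow> bool" where
  "C_on 0 S g \<longleftrightarrow> continuous_on S g"
| "C_on (Suc k) S g \<longleftrightarrow>
     (\<forall>x\<in>S. g differentiable (at x)) \<and> (\<forall>v. C_on k S (\<lambda>x. frechet_derivative g (at x) v))"

definition smooth_on :: "'a::real_normed_vector set \<Rightarrow> ('a \<Rightarrow> 'b::real_normed_vector) \<Rightarrow> bool" where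
  "smooth_on S g \<longleftrightarrow> (\<forall>k. C_on k S g)"

type_synonym ('p, 'e) chart = "'p set \<times> ('p \<Rightarrow> 'e)"

definition is_chart :: "'p topology \<Rightarrow> ('p, 'e::real_normed_vector) chart \<Rightarrow> bool" where
  "is_chart X = (\<lambda>(U, \<kappa>). openin X U \<and> open (\<kappa> ` U) \<and>
     homeomorphic_map (subtopology X U) (top_of_set (\<kappa> ` U)) \<kappa>)"

definition smooth_atlas :: "'p topology \<Rightarrow> ('p, 'e::real_normed_vector) chart set \<Rightarrow> bool" where
  "smooth_atlas X A \<longleftrightarrow> (\<forall>c\<in>A. is_chart X c) \<and> (\<Union>(U, \<kappa>)\<in>A. U) = topspace X \<and>
     (\<forall>(U, \<kappa>)\<in>A. \<forall>(V, \<mu>)\<in>A. smooth_on (\<kappa> ` (U \<inter> V)) (\<mu> \<circ> inv_into U \<kappa>))"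

text \<open>Manifolds have no boundary. The model space is an arbitrary finite-dimensional normed space
  rather than a type of class \<open>euclidean_space\<close>, because the latter excludes dimension zero.\<close>

definition smooth_manifold :: "'p topology \<Rightarrow> ('p, 'e::real_normed_vector) chart set \<Rightarrow> bool" where
  "smooth_manifold X A \<longleftrightarrow> (\<exists>B::'e set. finite B \<and> span B = UNIV) \<and>
     Hausdorff_space X \<and> second_countable X \<and> smooth_atlas X A"

definition smooth_map ::
  "'p topology \<Rightarrow> ('p, 'e::real_normed_vector) chart set \<Rightarrow>
   'q topology \<Rightarrow> ('q, 'd::real_normed_vector) chart set \<Rightarrow> ('p \<Rightarrow> 'q) \<Rightarrow> bool" where
  "smooth_map X A Y B g \<longleftrightarrow> continuous_map X Y g \<and>
     (\<forall>(U, \<kappa>)\<in>A. \<forall>(V, \<mu>)\<in>B. smooth_on (\<kappa> ` (U \<inter> g -` V)) (\<mu> \<circ> g \<circ> inv_into U \<kappa>))"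

definition diffeomorphism ::
  "'p topology \<Rightarrow> ('p, 'e::real_normed_vector) chart set \<Rightarrow>
   'q topology \<Rightarrow> ('q, 'd::real_normed_vector) chart set \<Rightarrow> ('p \<Rightarrow> 'q) \<Rightarrow> bool" where
  "diffeomorphism X A Y B g \<longleftrightarrow> bij_betw g (topspace X) (topspace Y) \<and>
     smooth_map X A Y B g \<and> smooth_map Y B X A (inv_into (topspace X) g)"

section \<open>Flows and vector fields\<close>

definition is_flow :: "'p topology \<Rightarrow> (real \<Rightarrow> 'p \<Rightarrow> 'p) \<Rightarrow> bool" where
  "is_flow X \<phi> \<longleftrightarrow>
     continuous_map (prod_topology euclideanreal X) X (\<lambda>(t, p). \<phi> t p) \<and>
     (\<forall>p\<in>topspace X. \<phi> 0 p = p) \<and>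
     (\<forall>p\<in>topspace X. \<forall>s t. \<phi> (s + t) p = \<phi> s (\<phi> t p))"

text \<open>A vector field is represented by its local expressions: \<open>W \<kappa> p\<close> is the coordinate vector,
  in the chart \<open>\<kappa>\<close>, of the tangent vector at the point \<open>p\<close> of the domain of \<open>\<kappa>\<close>.\<close>

definition generator :: "(real \<Rightarrow> 'p \<Rightarrow> 'p) \<Rightarrow> ('p \<Rightarrow> 'e::real_normed_vector) \<Rightarrow> 'p \<Rightarrow> 'e" where
  "generator \<psi> \<kappa> p = vector_derivative (\<lambda>t. \<kappa> (\<psi> t p)) (at 0)"

definition flow_generated_by ::
  "'p topology \<Rightarrow> ('p, 'e::real_normed_vector) chart set \<Rightarrow> (real \<Rightarrow> 'p \<Rightarrow> 'p) \<Rightarrow>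
   (('p \<Rightarrow> 'e) \<Rightarrow> 'p \<Rightarrow> 'e) \<Rightarrow> bool" where
  "flow_generated_by X A \<phi> W \<longleftrightarrow> is_flow X \<phi> \<and>
     (\<forall>p\<in>topspace X. \<forall>t. \<forall>(U, \<kappa>)\<in>A. \<phi> t p \<in> U \<longrightarrow>
        ((\<lambda>s. \<kappa> (\<phi> s p)) has_vector_derivative W \<kappa> (\<phi> t p)) (at t))"

section \<open>Expansive homeomorphisms\<close>

definition int_iter :: "('a \<Rightarrow> 'a) \<Rightarrow> int \<Rightarrow> 'a \<Rightarrow> 'a" where
  "int_iter f n = (if 0 \<le> n then f ^^ nat n else inv f ^^ nat (- n))"

definition expansive :: "('m::metric_space \<Rightarrow> 'm) \<Rightarrow> bool" where
  "expansive f \<longleftrightarrow>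
     (\<exists>c>0. \<forall>x y. (\<forall>n. dist (int_iter f n x) (int_iter f n y) < c) \<longrightarrow> x = y)"

section \<open>The suspension manifold\<close>

definition quotient_topology :: "'p topology \<Rightarrow> ('p \<times> 'p) set \<Rightarrow> 'p set topology" where
  "quotient_topology X r =
     topology (\<lambda>U. U \<subseteq> topspace X // r \<and> openin X {x \<in> topspace X. r `` {x} \<in> U})"

lemma openin_quotient_topology:
  "openin (quotient_topology X r) U \<longleftrightarrow>
     U \<subseteq> topspace X // r \<and> openin X {x \<in> topspace X. r `` {x} \<in> U}"
proof -
  let ?P = "\<lambda>U. U \<subseteq> topspace X // r \<and> openin X {x \<in> topspace X. r `` {x} \<in> U}"
  have "istopology ?P"
    unfolding istopology_def
  proof (intro conjI allI impI)
    fix S T assume S: "?P S" and T: "?P T"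
    have "{x \<in> topspace X. r `` {x} \<in> S \<inter> T} =
        {x \<in> topspace X. r `` {x} \<in> S} \<inter> {x \<in> topspace X. r `` {x} \<in> T}" by auto
    then show "S \<inter> T \<subseteq> topspace X // r" "openin X {x \<in> topspace X. r `` {x} \<in> S \<inter> T}"
      using S T by auto
  next
    fix K assume K: "\<forall>S\<in>K. ?P S"
    have "{x \<in> topspace X. r `` {x} \<in> \<Union>K} = (\<Union>S\<in>K. {x \<in> topspace X. r `` {x} \<in> S})" by auto
    then show "\<Union>K \<subseteq> topspace X // r" "openin X {x \<in> topspace X. r `` {x} \<in> \<Union>K}"
      using K by auto
  qed
  then show ?thesis
    by (simp add: quotient_topology_def topology_inverse')
qed

text \<open>The relation identifies \<open>(x, 1)\<close> with \<open>(f x, 0)\<close>; it is an equivalence relation because \<open>f\<close>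
  is injective.\<close>

definition susp_rel :: "('m \<Rightarrow> 'm) \<Rightarrow> (('m \<times> real) \<times> ('m \<times> real)) set" where
  "susp_rel f = Id_on (UNIV \<times> {0..1}) \<union>
     {((x, 1), (f x, 0)) | x. True} \<union> {((f x, 0), (x, 1)) | x. True}"

lemma equiv_susp_rel: "inj f \<Longrightarrow> equiv (UNIV \<times> {0..1}) (susp_rel f)"
  unfolding susp_rel_def by (rule equivI) (auto simp: refl_on_def sym_def trans_def inj_eq)

definition susp_space :: "('m \<Rightarrow> 'm) \<Rightarrow> ('m \<times> real) set set" where
  "susp_space f = (UNIV \<times> {0..1}) // susp_rel f"

definition susp_topology :: "('m::metric_space \<Rightarrow> 'm) \<Rightarrow> ('m \<times> real) set topology" where
  "susp_topology f = quotient_topology (top_of_set (UNIV \<times> {0..1})) (susp_rel f)"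

text \<open>\<open>susp_pt f x r\<close> is the class \<open>[x, r]\<close>, where a second coordinate outside \<open>[0, 1]\<close> is brought
  back by \<open>[x, r + 1] = [f x, r]\<close>.\<close>

definition susp_pt :: "('m \<Rightarrow> 'm) \<Rightarrow> 'm \<Rightarrow> real \<Rightarrow> ('m \<times> real) set" where
  "susp_pt f x r = susp_rel f `` {(int_iter f \<lfloor>r\<rfloor> x, frac r)}"

definition susp_flow :: "('m \<Rightarrow> 'm) \<Rightarrow> real \<Rightarrow> ('m \<times> real) set \<Rightarrow> ('m \<times> real) set" where
  "susp_flow f t p = the_elem ((\<lambda>(x, r). susp_pt f x (r + t)) ` p)"

text \<open>The smooth structure of the suspension manifold: if \<open>(U, \<kappa>)\<close> is a chart of \<open>M\<close>, then
  \<open>[x, r] \<mapsto> (\<kappa> x, r)\<close>, for \<open>x \<in> U\<close> and \<open>r\<close> in an open interval of length 1, is a chart. The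
  interval \<open>(0, 1)\<close> gives the product charts, the others cross the identified ends.\<close>

definition susp_chart ::
  "('m \<Rightarrow> 'm) \<Rightarrow> ('m, 'e) chart \<Rightarrow> real \<Rightarrow> (('m \<times> real) set, 'e \<times> real) chart" where
  "susp_chart f = (\<lambda>(U, \<kappa>) b.
     let D = U \<times> {b<..<b + 1}; pt = (\<lambda>(x, r). susp_pt f x r)
     in (pt ` D, (\<lambda>(x, r). (\<kappa> x, r)) \<circ> inv_into D pt))"

definition susp_atlas ::
  "('m \<Rightarrow> 'm) \<Rightarrow> ('m, 'e) chart set \<Rightarrow> (('m \<times> real) set, 'e \<times> real) chart set" where
  "susp_atlas f A = {susp_chart f c b | c b. c \<in> A}"

section \<open>Singular suspensions\<close>

definition brake_function ::
  "('m::metric_space \<Rightarrow> 'm) \<Rightarrow> ('m, 'e::real_normed_vector) chart set \<Rightarrow> ('m \<times> real) set \<Rightarrow>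
   (('m \<times> real) set \<Rightarrow> real) \<Rightarrow> bool" where
  "brake_function f A \<sigma> \<alpha> \<longleftrightarrow>
     smooth_map (susp_topology f) (susp_atlas f A) euclideanreal {(UNIV, id)} \<alpha> \<and>
     (\<forall>p\<in>susp_space f. 0 \<le> \<alpha> p) \<and> {p \<in> susp_space f. \<alpha> p = 0} = {\<sigma>}"

definition singular_suspension ::
  "('m::metric_space \<Rightarrow> 'm) \<Rightarrow> ('m, 'e::real_normed_vector) chart set \<Rightarrow>
   (real \<Rightarrow> ('m \<times> real) set \<Rightarrow> ('m \<times> real) set) \<Rightarrow> bool" where
  "singular_suspension f A \<phi> \<longleftrightarrow>
     (\<exists>a r\<^sub>0 \<alpha>. 0 < r\<^sub>0 \<and> r\<^sub>0 < 1 \<and> brake_function f A (susp_pt f a r\<^sub>0) \<alpha> \<and>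
        flow_generated_by (susp_topology f) (susp_atlas f A) \<phi>
          (\<lambda>\<kappa> p. \<alpha> p *\<^sub>R generator (susp_flow f) \<kappa> p))"

section \<open>Periodic orbits\<close>

definition has_period :: "(real \<Rightarrow> 'p \<Rightarrow> 'p) \<Rightarrow> 'p \<Rightarrow> real \<Rightarrow> bool" where
  "has_period \<phi> p T \<longleftrightarrow> 0 < T \<and> \<phi> T p = p \<and> (\<forall>s. 0 < s \<and> s < T \<longrightarrow> \<phi> s p \<noteq> p)"

definition periodic_orbits :: "'p set \<Rightarrow> (real \<Rightarrow> 'p \<Rightarrow> 'p) \<Rightarrow> real \<Rightarrow> 'p set set" where
  "periodic_orbits X \<phi> T = {range (\<lambda>t. \<phi> t p) | p. p \<in> X \<and> (\<exists>\<pi>\<in>{0..T}. has_period \<phi> p \<pi>)}"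

text \<open>The logarithm of the number of elements, with \<open>log 0 = -\<infinity>\<close>.\<close>

definition log_card :: "'a set \<Rightarrow> ereal" where
  "log_card S = (if infinite S then \<infinity> else if S = {} then -\<infinity> else ereal (ln (real (card S))))"

section \<open>Topological entropy\<close>

text \<open>The definition of Adler, Konheim and McAndrew by open covers, for a continuous self-map of a
  compact space; it needs no metric on the suspension manifold.\<close>

definition open_cover :: "'p topology \<Rightarrow> 'p set set \<Rightarrow> bool" where
  "open_cover X \<U> \<longleftrightarrow> (\<forall>U\<in>\<U>. openin X U) \<and> \<Union>\<U> = topspace X"

definition min_subcover :: "'p topology \<Rightarrow> 'p set set \<Rightarrow> nat" where
  "min_subcover X \<U> = (LEAST n. \<exists>\<V>\<subseteq>\<U>. finite \<V> \<and> card \<V> = n \<and> \<Union>\<V> = topspace X)"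

text \<open>The join \<open>\<U> \<or> h\<^sup>-\<^sup>1 \<U> \<or> \<dots> \<or> h\<^sup>-\<^sup>(\<^sup>n\<^sup>-\<^sup>1\<^sup>) \<U>\<close>.\<close>

definition cover_join :: "'p topology \<Rightarrow> ('p \<Rightarrow> 'p) \<Rightarrow> 'p set set \<Rightarrow> nat \<Rightarrow> 'p set set" where
  "cover_join X h \<U> n = {{x \<in> topspace X. \<forall>i<n. (h ^^ i) x \<in> u i} | u. \<forall>i<n. u i \<in> \<U>}"

text \<open>By subadditivity the upper limit is a limit.\<close>

definition cover_entropy :: "'p topology \<Rightarrow> ('p \<Rightarrow> 'p) \<Rightarrow> 'p set set \<Rightarrow> ereal" where
  "cover_entropy X h \<U> =
     limsup (\<lambda>n. ereal (ln (real (min_subcover X (cover_join X h \<U> n))) / real n))"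

definition topological_entropy :: "'p topology \<Rightarrow> ('p \<Rightarrow> 'p) \<Rightarrow> ereal" where
  "topological_entropy X h = (SUP \<U>\<in>{\<U>. open_cover X \<U>}. cover_entropy X h \<U>)"

end

theory Submission
  imports Defs "HOL-Real_Asymp.Real_Asymp"
begin

text \<open>An orbit of \<open>\<phi>\<close> is \<open>\<phi>\<^sub>t[x, r] = [x, \<rho> t]\<close>, where \<open>\<rho>\<close> is nondecreasing with slope at most
  \<open>K = max \<alpha>\<close>. A periodic orbit meets \<open>M \<times> {0}\<close> in a point \<open>[x, 0]\<close> with \<open>f\<^sup>n x = x\<close>, and over one
  period \<open>\<rho>\<close> grows by \<open>n\<close>. If two such points follow the same members of a fine cover
  at the times \<open>i / N\<close> up to a common approximate period, then their lifts stay close to each other, so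
  the two values of \<open>n\<close> agree, and the \<open>f\<close>-orbits of the points stay close for a whole period, hence
  forever; by expansiveness the points are equal. So the periodic orbits with period in a window of
  length \<open>1 / N\<close> below \<open>T\<close> are at most as many as the members of a subcover of the join of about
  \<open>T\<close> preimages under \<open>\<phi>\<^sub>1\<close>, and there are only about \<open>N T\<close> such windows.\<close>

section \<open>Open covers and growth rates\<close>

lemma open_cover_cover_join:
  assumes h: "continuous_map X X h" and U: "open_cover X \<U>"
  shows "open_cover X (cover_join X h \<U> n)"
proof -
  have iter: "continuous_map X X (h ^^ i)" for i
  proof (induction i)
    case (Suc i)
    then show ?case using continuous_map_compose[OF Suc h] by (simp add: o_def)
  qed (simp add: id_def)
  have "openin X {x \<in> topspace X. \<forall>i<n. (h ^^ i) x \<in> u i}" if "\<forall>i<n. u i \<in> \<U>" for u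
    using that
  proof (induction n)
    case (Suc n)
    have "openin X {x \<in> topspace X. (h ^^ n) x \<in> u n}"
      using U Suc.prems by (intro openin_continuous_map_preimage[OF iter]) (auto simp: open_cover_def)
    moreover have "{x \<in> topspace X. \<forall>i<Suc n. (h ^^ i) x \<in> u i} =
        {x \<in> topspace X. \<forall>i<n. (h ^^ i) x \<in> u i} \<inter> {x \<in> topspace X. (h ^^ n) x \<in> u n}"
      by (auto simp: less_Suc_eq)
    ultimately show ?case using Suc by auto
  qed simp
  moreover have "x \<in> \<Union>(cover_join X h \<U> n)" if x: "x \<in> topspace X" for x
  proof -
    have "\<exists>W\<in>\<U>. (h ^^ i) x \<in> W" for i
      using continuous_map_funspace[OF iter[of i]] x U by (auto simp: open_cover_def)
    then obtain u where "\<And>i. u i \<in> \<U> \<and> (h ^^ i) x \<in> u i" by metis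
    then show ?thesis using x by (auto simp: cover_join_def)
  qed
  ultimately show ?thesis unfolding open_cover_def by (auto simp: cover_join_def)
qed

lemma min_subcover_attained:
  assumes "compact_space X" "open_cover X \<U>"
  obtains \<V> where "\<V> \<subseteq> \<U>" "finite \<V>" "card \<V> = min_subcover X \<U>" "\<Union>\<V> = topspace X"
proof -
  obtain \<F> where "finite \<F>" "\<F> \<subseteq> \<U>" "topspace X \<subseteq> \<Union>\<F>"
    using compactinD[of X "topspace X" \<U>] assms by (auto simp: compact_space_def open_cover_def)
  moreover from this have "\<Union>\<F> = topspace X" using assms(2) unfolding open_cover_def by blast
  ultimately have "\<exists>n. \<exists>\<V>\<subseteq>\<U>. finite \<V> \<and> card \<V> = n \<and> \<Union>\<V> = topspace X" by blast
  then have "\<exists>\<V>\<subseteq>\<U>. finite \<V> \<and> card \<V> = min_subcover X \<U> \<and> \<Union>\<V> = topspace X"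
    unfolding min_subcover_def by (rule LeastI_ex)
  with that show thesis by blast
qed

lemma min_subcover_pos:
  assumes "compact_space X" "open_cover X \<U>" "topspace X \<noteq> {}"
  shows "0 < min_subcover X \<U>"
proof -
  obtain \<V> where "finite \<V>" "card \<V> = min_subcover X \<U>" "\<Union>\<V> = topspace X"
    using min_subcover_attained[OF assms(1,2)] by metis
  then show ?thesis using assms(3) card_gt_0_iff by (metis Union_empty)
qed

text \<open>Sending each point of \<open>S\<close> to a member of a smallest subcover containing it
  is injective, because no member holds two points of \<open>S\<close>. Periodic points are counted
  this way.\<close>

lemma card_le_min_subcover:
  assumes "compact_space X" "open_cover X \<U>" "S \<subseteq> topspace X"
    and sep: "\<And>W x y. \<lbrakk>W \<in> \<U>; x \<in> W; y \<in> W; x \<in> S; y \<in> S\<rbrakk> \<Longrightarrow> x = y"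
  shows "finite S" "card S \<le> min_subcover X \<U>"
proof -
  obtain \<V> where \<V>: "\<V> \<subseteq> \<U>" "finite \<V>" "card \<V> = min_subcover X \<U>" "\<Union>\<V> = topspace X"
    using min_subcover_attained[OF assms(1,2)] by metis
  have "\<forall>x\<in>S. \<exists>W\<in>\<V>. x \<in> W" using \<V>(4) assms(3) by blast
  then obtain w where w: "\<forall>x\<in>S. w x \<in> \<V> \<and> x \<in> w x" by metis
  have "inj_on w S"
  proof (rule inj_onI)
    fix x y assume "x \<in> S" "y \<in> S" "w x = w y"
    then show "x = y" using sep[of "w x" x y] w \<V>(1) by auto
  qed
  moreover have "w ` S \<subseteq> \<V>" using w by blast
  ultimately show "finite S" "card S \<le> min_subcover X \<U>"
    using \<V>(2,3) inj_on_finite card_inj_on_le by metis+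
qed

text \<open>With \<open>m = nat \<lfloor>T\<rfloor> + 2\<close>, the factor \<open>N * m\<close>
  contributes only a logarithm to the exponent, and \<open>m / T\<close> tends to 1, so dividing by
  \<open>T\<close> leaves the growth rate of \<open>c\<close> alone. The values of \<open>l\<close>
  are extended reals because the logarithm of a zero count is minus infinity.\<close>

lemma Limsup_log_growth_le:
  fixes l :: "real \<Rightarrow> ereal" and c :: "nat \<Rightarrow> nat" and N :: real
  assumes "0 < N" and pos: "\<And>n. 0 < c n"
    and le: "\<And>T. 0 < T \<Longrightarrow>
      l T \<le> ereal (ln (N * real (nat \<lfloor>T\<rfloor> + 2) * real (c (nat \<lfloor>T\<rfloor> + 2))))"
  shows "Limsup at_top (\<lambda>T. ereal (1 / T) * l T) \<le> limsup (\<lambda>n. ereal (ln (real (c n)) / real n))"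
    (is "_ \<le> ?h")
proof (rule dense_ge)
  fix z assume "?h < z"
  show "Limsup at_top (\<lambda>T. ereal (1 / T) * l T) \<le> z"
  proof (cases z)
    case (real B)
    \<comment> \<open>Counts are at least 1, so the rate is nonnegative and \<open>B\<close> is
      positive. The positive sign is what allows \<open>m * B\<close> to be bounded by
      \<open>(T + 2) * B\<close> below.\<close>
    have c1: "1 \<le> real (c n)" for n using pos[of n] by simp
    have "0 \<le> ereal (ln (real (c n)) / real n)" for n using c1[of n] by simp
    then have "0 \<le> ?h"
      by (intro order_trans[OF _ Liminf_le_Limsup] Liminf_bounded) auto
    then have "0 < z" using \<open>?h < z\<close> by (rule order_le_less_trans)
    then have "0 < B" using real by simp
    have "\<forall>\<^sub>F n in sequentially. ereal (ln (real (c n)) / real n) < ereal B"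
      using Limsup_lessD[OF \<open>?h < z\<close>] real by simp
    moreover have "filterlim (\<lambda>T::real. nat \<lfloor>T\<rfloor> + 2) sequentially at_top" by real_asymp
    ultimately have "\<forall>\<^sub>F T::real in at_top. ln (real (c (nat \<lfloor>T\<rfloor> + 2))) / real (nat \<lfloor>T\<rfloor> + 2) < B"
      by (auto simp: filterlim_iff)
    then have "\<forall>\<^sub>F T in at_top. ereal (1 / T) * l T \<le> ereal ((ln (N * (T + 2)) + (T + 2) * B) / T)"
      using eventually_gt_at_top[of "0::real"]
    proof eventually_elim
      case (elim T)
      define m where "m = nat \<lfloor>T\<rfloor> + 2"
      have m: "0 < m" "real m \<le> T + 2" using elim unfolding m_def by linarith+
      have "ln (N * real m * real (c m)) = ln (N * real m) + ln (real (c m))"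
        using \<open>0 < N\<close> m pos[of m] by (simp add: ln_mult)
      moreover have "ln (N * real m) \<le> ln (N * (T + 2))" using \<open>0 < N\<close> m by simp
      moreover have "ln (real (c m)) \<le> real m * B"
        using elim(1) m(1) unfolding m_def[symmetric] by (simp add: pos_divide_less_eq mult.commute)
      moreover have "real m * B \<le> (T + 2) * B" using m \<open>0 < B\<close> by simp
      ultimately have "l T \<le> ereal (ln (N * (T + 2)) + (T + 2) * B)"
        using le[of T] elim by (auto simp: m_def intro: order_trans)
      then have "ereal (1 / T) * l T \<le> ereal (1 / T) * ereal (ln (N * (T + 2)) + (T + 2) * B)"
        using elim by (intro ereal_mult_left_mono) auto
      then show ?case by (simp add: field_simps)
    qed
    then have "Limsup at_top (\<lambda>T. ereal (1 / T) * l T)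
        \<le> Limsup at_top (\<lambda>T. ereal ((ln (N * (T + 2)) + (T + 2) * B) / T))"
      by (rule Limsup_mono)
    also have "((\<lambda>T. (ln (N * (T + 2)) + (T + 2) * B) / T) \<longlongrightarrow> B) at_top"
      using \<open>0 < N\<close> by real_asymp
    then have "Limsup at_top (\<lambda>T. ereal ((ln (N * (T + 2)) + (T + 2) * B) / T)) = ereal B"
      by (intro lim_imp_Limsup) auto
    finally show ?thesis using real by simp
  qed (use \<open>?h < z\<close> in auto)
qed

section \<open>Geometry of the suspension\<close>

lemma int_iter_0 [simp]: "int_iter f 0 x = x"
  by (simp add: int_iter_def)

lemma int_iter_1 [simp]: "int_iter f 1 x = f x"
  by (simp add: int_iter_def)

locale suspension =
  fixes f :: "'m::metric_space \<Rightarrow> 'm"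
  assumes bij: "bij f"
    and cont: "continuous_on UNIV f"
    and cont_inv: "continuous_on UNIV (inv f)"
begin

lemma int_iter_succ: "int_iter f (k + 1) x = f (int_iter f k x)"
proof (cases "0 \<le> k")
  case True
  then show ?thesis by (simp add: int_iter_def nat_add_distrib)
next
  case False
  then have "nat (- k) = Suc (nat (- (k + 1)))" by linarith
  with False show ?thesis
    by (auto simp: int_iter_def surj_f_inv_f[OF bij_is_surj[OF bij]])
qed

lemma int_iter_add: "int_iter f (j + k) x = int_iter f j (int_iter f k x)"
proof (induction j rule: int_induct[where k = 0])
  case (step1 i)
  then show ?case using int_iter_succ[of "i + k" x] int_iter_succ[of i] by (simp add: ac_simps)
next
  case (step2 i)
  then have "f (int_iter f (i - 1 + k) x) = f (int_iter f (i - 1) (int_iter f k x))"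
    using int_iter_succ[of "i - 1 + k" x] int_iter_succ[of "i - 1" "int_iter f k x"]
    by (simp add: algebra_simps)
  then show ?case using bij by (simp add: bij_def inj_eq)
qed simp

lemma int_iter_cancel: "int_iter f (- k) (int_iter f k x) = x" "int_iter f k (int_iter f (- k) x) = x"
  by (simp_all flip: int_iter_add)

lemma continuous_int_iter: "continuous_on UNIV (int_iter f k)"
proof -
  have "continuous_on UNIV (g ^^ n)" if "continuous_on UNIV g" for g :: "'m \<Rightarrow> 'm" and n
  proof (induction n)
    case (Suc n)
    show ?case
      unfolding funpow.simps using Suc that
      by (metis continuous_on_compose continuous_on_subset top_greatest)
  qed (simp add: id_def)
  then show ?thesis using cont cont_inv by (simp add: int_iter_def[abs_def])
qed

lemma int_iter_periodic:
  assumes "int_iter f n x = x"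
  shows "int_iter f (k * n) x = x"
proof (induction k rule: int_induct[where k = 0])
  case (step1 i)
  then show ?case using assms by (simp add: distrib_right int_iter_add)
next
  case (step2 i)
  have "int_iter f ((i - 1) * n) (int_iter f n x) = int_iter f (i * n) x"
    using int_iter_add[of "(i - 1) * n" n x] by (simp add: algebra_simps)
  then show ?case using step2 assms by simp
qed simp

text \<open>The exponents differ by a multiple of \<open>n\<close>, which fixes \<open>x\<close>.
  Closeness of two orbits over one common period thereby extends to all integer times.\<close>

lemma int_iter_mod:
  assumes "int_iter f n x = x"
  shows "int_iter f (k mod n) x = int_iter f k x"
  using int_iter_add[of "k mod n" "k div n * n" x] int_iter_periodic[OF assms] by simp

section \<open>Classes in the suspension and their representatives\<close>

abbreviation pt :: "'m \<times> real \<Rightarrow> ('m \<times> real) set" where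
  "pt \<equiv> \<lambda>(x, r). susp_pt f x r"

lemma equiv_rel: "equiv (UNIV \<times> {0..1}) (susp_rel f)"
  using bij by (simp add: equiv_susp_rel bij_def)

text \<open>Every class has a normal form with second coordinate in \<open>[0, 1)\<close>, and there
  the relation is plain equality. Undoing the two normalizations leaves an integer shift. The
  suspension thus becomes the quotient of the product with the whole real line by an integer
  action.\<close>

lemma susp_pt_eq_iff:
  "susp_pt f x r = susp_pt f y s \<longleftrightarrow> (\<exists>k. r = s + of_int k \<and> y = int_iter f k x)"
proof -
  have mem: "(int_iter f \<lfloor>r\<rfloor> x, frac r) \<in> UNIV \<times> {0..1}" for x r
    using frac_lt_1[of r] by auto
  have "susp_pt f x r = susp_pt f y s \<longleftrightarrow>
      ((int_iter f \<lfloor>r\<rfloor> x, frac r), (int_iter f \<lfloor>s\<rfloor> y, frac s)) \<in> susp_rel f"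
    unfolding susp_pt_def using eq_equiv_class_iff[OF equiv_rel mem mem] .
  also have "\<dots> \<longleftrightarrow> int_iter f \<lfloor>r\<rfloor> x = int_iter f \<lfloor>s\<rfloor> y \<and> frac r = frac s"
    using frac_lt_1[of r] frac_lt_1[of s] frac_ge_0[of r] frac_ge_0[of s]
    unfolding susp_rel_def by auto
  also have "\<dots> \<longleftrightarrow> (\<exists>k. r = s + of_int k \<and> y = int_iter f k x)"
  proof
    assume *: "int_iter f \<lfloor>r\<rfloor> x = int_iter f \<lfloor>s\<rfloor> y \<and> frac r = frac s"
    have "y = int_iter f (- \<lfloor>s\<rfloor>) (int_iter f \<lfloor>s\<rfloor> y)" by (simp add: int_iter_cancel)
    also have "\<dots> = int_iter f (- \<lfloor>s\<rfloor> + \<lfloor>r\<rfloor>) x" by (simp only: int_iter_add *)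
    finally have "y = int_iter f (\<lfloor>r\<rfloor> - \<lfloor>s\<rfloor>) x" by (simp add: add.commute[of "- _"])
    moreover have "r = s + of_int (\<lfloor>r\<rfloor> - \<lfloor>s\<rfloor>)" using * by (simp add: frac_def)
    ultimately show "\<exists>k. r = s + of_int k \<and> y = int_iter f k x" by blast
  next
    assume "\<exists>k. r = s + of_int k \<and> y = int_iter f k x"
    then obtain k where "r = s + of_int k" "y = int_iter f k x" by blast
    then show "int_iter f \<lfloor>r\<rfloor> x = int_iter f \<lfloor>s\<rfloor> y \<and> frac r = frac s"
      by (simp add: frac_def int_iter_add)
  qed
  finally show ?thesis .
qed

lemma susp_pt_shift: "susp_pt f (int_iter f k x) r = susp_pt f x (r + of_int k)"
  by (subst eq_commute) (auto simp: susp_pt_eq_iff)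

text \<open>The integer shift has absolute value below 1, so it vanishes. Hence \<open>pt\<close> is
  injective over every open interval of length 1, as the charts require.\<close>

lemma susp_pt_eq_iff_close:
  assumes "\<bar>r - s\<bar> < 1"
  shows "susp_pt f x r = susp_pt f y s \<longleftrightarrow> x = y \<and> r = s"
proof
  assume "susp_pt f x r = susp_pt f y s"
  then obtain k where k: "r = s + of_int k" "y = int_iter f k x" by (auto simp: susp_pt_eq_iff)
  with assms have "\<bar>of_int k :: real\<bar> < 1" by simp
  then have "k = 0" by linarith
  with k show "x = y \<and> r = s" by simp
qed simp

lemma class_eq_susp_pt:
  assumes "r \<in> {0..1}"
  shows "susp_rel f `` {(x, r)} = susp_pt f x r"
proof (cases "r = 1")
  case True
  have "((x, 1), (f x, 0)) \<in> susp_rel f" by (simp add: susp_rel_def)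
  then have "susp_rel f `` {(x, 1)} = susp_rel f `` {(f x, 0)}"
    by (rule equiv_class_eq[OF equiv_rel])
  then show ?thesis using True by (simp add: susp_pt_def)
next
  case False
  then have "\<lfloor>r\<rfloor> = 0" "frac r = r" using assms by (auto simp: frac_eq floor_eq_iff)
  then show ?thesis by (simp add: susp_pt_def)
qed

lemma susp_pt_in_space [simp]: "susp_pt f x r \<in> susp_space f"
  using frac_lt_1[of r] frac_ge_0[of r] unfolding susp_pt_def susp_space_def
  by (intro quotientI) auto

lemma susp_space_image: "susp_space f = pt ` (UNIV \<times> {0..1})"
proof
  show "susp_space f \<subseteq> pt ` (UNIV \<times> {0..1})"
    unfolding susp_space_def quotient_def using class_eq_susp_pt by force
qed auto

lemma susp_space_cases:
  assumes "p \<in> susp_space f"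
  obtains x r where "p = susp_pt f x r"
  using assms unfolding susp_space_image by auto

lemma susp_pt_mem:
  assumes "(y, s) \<in> susp_pt f x r"
  shows "susp_pt f y s = susp_pt f x r"
proof -
  from assms have "((int_iter f \<lfloor>r\<rfloor> x, frac r), (y, s)) \<in> susp_rel f" by (simp add: susp_pt_def)
  moreover from this have "s \<in> {0..1}" by (auto simp: susp_rel_def)
  ultimately show ?thesis
    using equiv_class_eq[OF equiv_rel] class_eq_susp_pt[of s y] by (auto simp: susp_pt_def)
qed

lemma susp_pt_nonempty: "susp_pt f x r \<noteq> {}"
  using equiv_class_self[OF equiv_rel, of "(int_iter f \<lfloor>r\<rfloor> x, frac r)"] frac_lt_1[of r]
  by (auto simp: susp_pt_def)

text \<open>A function that is constant on representatives maps the nonempty class to a singleton.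
  This makes the functions defined through \<open>the_elem\<close>, namely \<open>susp_flow\<close>
  and \<open>circ\<close>, computable on any representative.\<close>

lemma the_elem_class:
  assumes "\<And>y s. susp_pt f y s = susp_pt f x r \<Longrightarrow> g (y, s) = g (x, r)"
  shows "the_elem (g ` susp_pt f x r) = g (x, r)"
proof -
  have "g ` susp_pt f x r \<subseteq> {g (x, r)}" using assms[OF susp_pt_mem] by auto
  then have "g ` susp_pt f x r = {g (x, r)}"
    using subset_singletonD susp_pt_nonempty[of x r] image_is_empty by metis
  then show ?thesis by simp
qed

lemma susp_flow_susp_pt: "susp_flow f t (susp_pt f x r) = susp_pt f x (r + t)"
  unfolding susp_flow_def
  by (subst the_elem_class) (auto simp: susp_pt_eq_iff)

section \<open>Quotient topology, open sets and compactness\<close>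

lemma topspace_susp [simp]: "topspace (susp_topology f) = susp_space f"
proof -
  have "openin (susp_topology f) (susp_space f)"
  proof -
    have *: "{z \<in> UNIV \<times> {0..1::real}. susp_rel f `` {z} \<in> (UNIV \<times> {0..1}) // susp_rel f} = UNIV \<times> {0..1}"
      by (auto intro: quotientI)
    then show ?thesis
      unfolding susp_topology_def openin_quotient_topology susp_space_def
      using openin_subtopology_self[of "UNIV \<times> {0..1::real}"] by (simp add: *)
  qed
  then have "susp_space f \<subseteq> topspace (susp_topology f)" by (rule openin_subset)
  moreover have "U \<subseteq> susp_space f" if "openin (susp_topology f) U" for U
    using that by (simp add: susp_topology_def openin_quotient_topology susp_space_def)
  ultimately show ?thesis using openin_topspace by (metis subset_antisym)
qed

lemma openin_susp_iff:
  "openin (susp_topology f) U \<longleftrightarrow> U \<subseteq> susp_space f \<and>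
     openin (top_of_set (UNIV \<times> {0..1})) {z \<in> UNIV \<times> {0..1}. pt z \<in> U}"
proof -
  have "{z \<in> UNIV \<times> {0..1}. susp_rel f `` {z} \<in> U} = {z \<in> UNIV \<times> {0..1}. pt z \<in> U}"
    using class_eq_susp_pt by auto
  then show ?thesis
    unfolding susp_topology_def openin_quotient_topology susp_space_def by simp
qed

lemma continuous_map_from_susp:
  assumes "continuous_map (top_of_set (UNIV \<times> {0..1})) Y (g \<circ> pt)"
  shows "continuous_map (susp_topology f) Y g"
  unfolding continuous_map_def
proof (intro conjI funcsetI allI impI)
  show "g p \<in> topspace Y" if "p \<in> topspace (susp_topology f)" for p
    using that continuous_map_funspace[OF assms] unfolding topspace_susp susp_space_image by force
  fix V assume V: "openin Y V"
  have "openin (top_of_set (UNIV \<times> {0..1})) {z \<in> UNIV \<times> {0..1}. (g \<circ> pt) z \<in> V}"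
    using openin_continuous_map_preimage[OF assms V] by simp
  moreover have "{z \<in> UNIV \<times> {0..1}. (g \<circ> pt) z \<in> V} =
      {z \<in> UNIV \<times> {0..1}. pt z \<in> {p \<in> susp_space f. g p \<in> V}}"
    by auto
  ultimately show "openin (susp_topology f) {p \<in> topspace (susp_topology f). g p \<in> V}"
    unfolding openin_susp_iff by auto
qed

lemma continuous_map_pt: "continuous_map (top_of_set (UNIV \<times> {0..1})) (susp_topology f) pt"
  unfolding continuous_map_def
proof (intro conjI funcsetI allI impI)
  fix U assume "openin (susp_topology f) U"
  then show "openin (top_of_set (UNIV \<times> {0..1})) {z \<in> topspace (top_of_set (UNIV \<times> {0..1})). pt z \<in> U}"
    using openin_susp_iff by simp
qed auto

lemma openin_pt_image:
  assumes "open S"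
  shows "openin (susp_topology f) (pt ` S)"
proof -
  have "open ((\<lambda>(x, r). (int_iter f k x, r - of_int k)) -` S)" for k
    using continuous_int_iter[of k]
    by (intro open_vimage[OF assms])
      (auto simp: case_prod_unfold intro!: continuous_intros continuous_on_compose2[of UNIV "int_iter f k"])
  then have "open (\<Union>k. (\<lambda>(x, r). (int_iter f k x, r - of_int k)) -` S)" by blast
  moreover have "{z \<in> UNIV \<times> {0..1}. pt z \<in> pt ` S} =
      (UNIV \<times> {0..1}) \<inter> (\<Union>k. (\<lambda>(x, r). (int_iter f k x, r - of_int k)) -` S)"
  proof -
    have "susp_pt f x r \<in> pt ` S \<longleftrightarrow> (\<exists>k. (int_iter f k x, r - of_int k) \<in> S)" for x r
    proof
      assume "susp_pt f x r \<in> pt ` S"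
      then obtain y s where "(y, s) \<in> S" "susp_pt f x r = susp_pt f y s" by auto
      moreover from this obtain k where "r = s + of_int k" "y = int_iter f k x"
        by (auto simp: susp_pt_eq_iff)
      ultimately have "(int_iter f k x, r - of_int k) \<in> S" by simp
      then show "\<exists>k. (int_iter f k x, r - of_int k) \<in> S" by blast
    next
      assume "\<exists>k. (int_iter f k x, r - of_int k) \<in> S"
      then obtain k where "(int_iter f k x, r - of_int k) \<in> S" by blast
      moreover have "susp_pt f x r = pt (int_iter f k x, r - of_int k)"
        by (simp add: susp_pt_shift)
      ultimately show "susp_pt f x r \<in> pt ` S" by blast
    qed
    then show ?thesis by (simp add: set_eq_iff split_beta del: image_iff)
  qed
  ultimately show ?thesis
    unfolding openin_susp_iff by (auto simp: openin_open)
qed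

lemma compact_space_susp:
  assumes "compact (UNIV :: 'm set)"
  shows "compact_space (susp_topology f)"
proof -
  have "compactin (susp_topology f) (pt ` (UNIV \<times> {0..1}))"
    using assms by (intro image_compactin[OF _ continuous_map_pt])
      (simp add: compactin_subtopology compact_Times)
  then show ?thesis by (simp add: compact_space_def flip: susp_space_image)
qed

text \<open>The second coordinate is determined only modulo 1, so it is recorded as a point of the
  unit circle. Lifting this point along an orbit recovers a real second coordinate.\<close>

definition circ :: "('m \<times> real) set \<Rightarrow> complex" where
  "circ p = the_elem ((\<lambda>(x, r). exp (2 * pi * \<i> * r)) ` p)"

lemma circ_susp_pt: "circ (susp_pt f x r) = exp (2 * pi * \<i> * r)"
  unfolding circ_def
  by (subst the_elem_class) (auto simp: susp_pt_eq_iff exp_eq algebra_simps)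

lemma continuous_map_circ: "continuous_map (susp_topology f) euclidean circ"
  by (rule continuous_map_from_susp)
    (auto simp: o_def case_prod_unfold circ_susp_pt intro!: continuous_intros)

lemma susp_chart_coords:
  assumes "x \<in> U" "b < r" "r < b + 1"
  shows "snd (susp_chart f (U, \<kappa>) b) (susp_pt f x r) = (\<kappa> x, r)"
proof -
  have "inj_on pt (U \<times> {b<..<b + 1})"
    by (auto simp: inj_on_def susp_pt_eq_iff_close)
  then have "inv_into (U \<times> {b<..<b + 1}) pt (pt (x, r)) = (x, r)"
    using assms by (intro inv_into_f_f) auto
  then show ?thesis by (simp add: susp_chart_def Let_def)
qed

text \<open>For small times the ordinary flow stays in the chart, keeps the first coordinate and
  moves the second at unit speed.\<close>

lemma generator_susp_flow:
  fixes \<kappa> :: "'m \<Rightarrow> 'e::real_normed_vector"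
  assumes "x \<in> U" "b < r" "r < b + 1"
  shows "generator (susp_flow f) (snd (susp_chart f (U, \<kappa>) b)) (susp_pt f x r) = (0, 1)"
  unfolding generator_def
proof (rule vector_derivative_at)
  have "((\<lambda>t. (\<kappa> x, r + t)) has_vector_derivative (0, 1)) (at 0)"
    by (auto intro!: derivative_eq_intros has_vector_derivative_Pair)
  then show "((\<lambda>t. snd (susp_chart f (U, \<kappa>) b) (susp_flow f t (susp_pt f x r)))
      has_vector_derivative (0, 1)) (at 0)"
    by (rule has_vector_derivative_transform_within_open[where S = "{b - r<..<b + 1 - r}"])
      (use assms in \<open>auto simp: susp_flow_susp_pt susp_chart_coords\<close>)
qed

text \<open>Closeness is imposed on the base points and on their images, because a tube may cross an
  integer level, after which the floor of the lifted height points to the next iterate of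
  \<open>f\<close>.\<close>

definition tube :: "real \<Rightarrow> 'm \<Rightarrow> real \<Rightarrow> ('m \<times> real) set set" where
  "tube c z b = pt ` ({y. dist z y < c / 2 \<and> dist (f z) (f y) < c / 2} \<times> {b<..<b + 1/8})"

lemma open_cover_tubes:
  assumes "0 < c"
  shows "open_cover (susp_topology f) {tube c z b | z b. 0 \<le> b \<and> b < 1}"
proof -
  have open_W: "open {y. dist z y < c / 2 \<and> dist (f z) (f y) < c / 2}" for z
    using cont by (intro open_Collect_conj open_Collect_less continuous_intros) auto
  have open_tube: "openin (susp_topology f) (tube c z b)" for z b
    unfolding tube_def by (intro openin_pt_image open_Times open_W) auto
  have covered: "susp_pt f x r \<in> \<Union>{tube c z b | z b. 0 \<le> b \<and> b < 1}" for x r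
  proof -
    \<comment> \<open>The offset 1/16 is half the height of a tube, so the point lies at
      mid-height.\<close>
    define b where "b = frac (r - 1/16)"
    define k where "k = \<lfloor>r - 1/16\<rfloor>"
    have b: "0 \<le> b" "b < 1" "r = b + 1/16 + of_int k"
      by (auto simp: b_def k_def frac_lt_1) (simp add: frac_def)
    have "susp_pt f x r = pt (int_iter f k x, b + 1/16)"
      by (simp add: susp_pt_shift b(3))
    also have "\<dots> \<in> tube c (int_iter f k x) b"
      unfolding tube_def using assms by (intro imageI) auto
    finally show ?thesis using b by blast
  qed
  have "susp_space f \<subseteq> \<Union>{tube c z b | z b. 0 \<le> b \<and> b < 1}"
  proof
    fix p assume "p \<in> susp_space f"
    then obtain x r where "p = susp_pt f x r" by (rule susp_space_cases)
    then show "p \<in> \<Union>{tube c z b | z b. 0 \<le> b \<and> b < 1}" by (simp only: covered)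
  qed
  moreover have "tube c z b \<subseteq> susp_space f" for z b
    using openin_subset[OF open_tube] by simp
  ultimately show ?thesis using open_tube unfolding open_cover_def topspace_susp by blast
qed

text \<open>Two heights within 7/8 of each other must lie in the same lifted copy of the tube, and
  then they differ by less than its height 1/8. A coarse bound is thus sharpened, which drives the
  later induction along an orbit.\<close>

lemma tube_coords:
  assumes "susp_pt f x r \<in> tube c z b" "susp_pt f y s \<in> tube c z b" "0 \<le> b" "b < 1"
    and rs: "\<bar>r - s\<bar> < 7/8"
  shows "\<bar>r - s\<bar> < 1/8" "dist (int_iter f \<lfloor>r\<rfloor> x) (int_iter f \<lfloor>r\<rfloor> y) < c"
proof -
  obtain x' r' where x': "dist z x' < c / 2" "dist (f z) (f x') < c / 2" "b < r'" "r' < b + 1/8"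
      "susp_pt f x r = susp_pt f x' r'"
    using assms(1) by (auto simp: tube_def)
  obtain y' s' where y': "dist z y' < c / 2" "dist (f z) (f y') < c / 2" "b < s'" "s' < b + 1/8"
      "susp_pt f y s = susp_pt f y' s'"
    using assms(2) by (auto simp: tube_def)
  obtain k where k: "r = r' + of_int k" "x' = int_iter f k x" using x'(5) by (auto simp: susp_pt_eq_iff)
  obtain l where l: "s = s' + of_int l" "y' = int_iter f l y" using y'(5) by (auto simp: susp_pt_eq_iff)
  \<comment> \<open>The bounds 7/8 on \<open>r - s\<close> and 1/8 on \<open>r' - s'\<close> add up
    to 1.\<close>
  have "\<bar>of_int k - of_int l :: real\<bar> < 1" using rs k l x'(3,4) y'(3,4) by linarith
  then have "l = k" by linarith
  then show "\<bar>r - s\<bar> < 1/8" unfolding k(1) l(1) using x'(3,4) y'(3,4) by linarith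
  have close: "dist x' y' < c" "dist (f x') (f y') < c"
    using x' y' dist_triangle_half_r by metis+
  \<comment> \<open>Here \<open>r'\<close> lies strictly between 0 and 9/8, so its floor is 0 or 1.
    The two cases use the closeness of the base points and of their images.\<close>
  have "k \<le> \<lfloor>r\<rfloor>" "\<lfloor>r\<rfloor> \<le> k + 1" using k x'(3,4) \<open>0 \<le> b\<close> \<open>b < 1\<close> by linarith+
  then consider "\<lfloor>r\<rfloor> = k" | "\<lfloor>r\<rfloor> = k + 1" by linarith
  then show "dist (int_iter f \<lfloor>r\<rfloor> x) (int_iter f \<lfloor>r\<rfloor> y) < c"
    using close k(2) l(2) \<open>l = k\<close> by cases (simp_all add: int_iter_succ)
qed

end

section \<open>Time changes of the suspension flow\<close>

locale suspension_time_change = suspension f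
  for f :: "'m::metric_space \<Rightarrow> 'm" +
  fixes A :: "('m, 'e::real_normed_vector) chart set"
    and \<phi> :: "real \<Rightarrow> ('m \<times> real) set \<Rightarrow> ('m \<times> real) set"
    and \<alpha> :: "('m \<times> real) set \<Rightarrow> real" and K :: real
  assumes atlas: "smooth_atlas euclidean A"
    and generated: "flow_generated_by (susp_topology f) (susp_atlas f A) \<phi>
          (\<lambda>\<kappa> p. \<alpha> p *\<^sub>R generator (susp_flow f) \<kappa> p)"
    and speed_nonneg: "p \<in> susp_space f \<Longrightarrow> 0 \<le> \<alpha> p"
    and speed_le: "p \<in> susp_space f \<Longrightarrow> \<alpha> p \<le> K"
begin

lemma flow_0 [simp]: "p \<in> susp_space f \<Longrightarrow> \<phi> 0 p = p"
  and flow_add: "p \<in> susp_space f \<Longrightarrow> \<phi> (s + t) p = \<phi> s (\<phi> t p)"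
  using generated by (auto simp: flow_generated_by_def is_flow_def)

lemma continuous_map_flow:
  "continuous_map (prod_topology euclideanreal (susp_topology f)) (susp_topology f) (\<lambda>(t, p). \<phi> t p)"
  using generated by (auto simp: flow_generated_by_def is_flow_def)

lemma continuous_map_flow_time: "continuous_map (susp_topology f) (susp_topology f) (\<phi> t)"
proof -
  have "continuous_map (susp_topology f) (prod_topology euclideanreal (susp_topology f)) (\<lambda>p. (t, p))"
    by (simp add: continuous_map_pairedI)
  from continuous_map_compose[OF this continuous_map_flow] show ?thesis by (simp add: o_def)
qed

lemma continuous_map_orbit:
  assumes "p \<in> susp_space f"
  shows "continuous_map euclideanreal (susp_topology f) (\<lambda>t. \<phi> t p)"
proof -
  have "continuous_map euclideanreal (prod_topology euclideanreal (susp_topology f)) (\<lambda>t. (t, p))"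
    using assms by (simp add: continuous_map_pairedI)
  from continuous_map_compose[OF this continuous_map_flow] show ?thesis by (simp add: o_def)
qed

lemma flow_in_space [simp]: "p \<in> susp_space f \<Longrightarrow> \<phi> t p \<in> susp_space f"
  using continuous_map_funspace[OF continuous_map_flow_time[of t]] by auto

text \<open>The second coordinate is lifted from the circle; in a chart the first coordinate then has
  derivative zero, so it is locally constant.\<close>

lemma orbit_lift:
  obtains \<rho> where "\<rho> 0 = r" "\<And>t. \<phi> t (susp_pt f x r) = susp_pt f x (\<rho> t)"
    "\<And>t. (\<rho> has_real_derivative \<alpha> (\<phi> t (susp_pt f x r))) (at t)"
proof -
  define p where "p = susp_pt f x r"
  have p: "p \<in> susp_space f" by (simp add: p_def)
  have "continuous_map euclideanreal euclidean (circ \<circ> (\<lambda>t. \<phi> t p))"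
    using continuous_map_compose[OF continuous_map_orbit[OF p] continuous_map_circ] .
  then have cont_circ: "continuous_on UNIV (\<lambda>t. circ (\<phi> t p))" by (simp add: o_def)
  have circ_cases: "\<exists>y s. \<phi> t p = susp_pt f y s \<and> circ (\<phi> t p) = exp (2 * pi * \<i> * of_real s)" for t
    using susp_space_cases[OF flow_in_space[OF p]] circ_susp_pt by metis
  have nz: "circ (\<phi> t p) \<noteq> 0" for t using circ_cases[of t] by auto
  \<comment> \<open>A nowhere vanishing continuous function on the contractible real line has a
    continuous logarithm. Its imaginary part over \<open>2 * pi\<close> is a height of the
    orbit.\<close>
  have "\<exists>g. continuous_on UNIV g \<and> (\<forall>t. circ (\<phi> t p) = exp (g t))"
    by (rule continuous_logarithm_on_contractible[OF cont_circ convex_imp_contractible[OF convex_UNIV] nz]) auto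
  then obtain g where g: "continuous_on UNIV g" "\<And>t. circ (\<phi> t p) = exp (g t)" by auto
  define \<rho>' where "\<rho>' t = Im (g t) / (2 * pi)" for t
  have cont': "continuous_on UNIV \<rho>'" unfolding \<rho>'_def by (intro continuous_intros g) auto
  have "\<exists>y. \<phi> t p = susp_pt f y (\<rho>' t)" for t
  proof -
    obtain y s where ys: "\<phi> t p = susp_pt f y s" "exp (g t) = exp (2 * pi * \<i> * of_real s)"
      using circ_cases[of t] g by auto
    then obtain n where "g t = 2 * pi * \<i> * of_real s + of_int (2 * n) * pi * \<i>"
      by (auto simp: exp_eq)
    then have "Im (g t) = 2 * pi * s + 2 * n * pi" by simp
    then have "\<rho>' t = s + of_int n" by (simp add: \<rho>'_def field_simps)
    then have "\<phi> t p = susp_pt f (int_iter f (- n) y) (\<rho>' t)"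
      by (simp add: susp_pt_shift ys)
    then show ?thesis by blast
  qed
  then obtain x' where x': "\<And>t. \<phi> t p = susp_pt f (x' t) (\<rho>' t)" by metis
  have "susp_pt f (x' 0) (\<rho>' 0) = susp_pt f x r" using x'[of 0] p by (simp add: p_def)
  then obtain k where k: "\<rho>' 0 = r + of_int k" "x = int_iter f k (x' 0)"
    by (auto simp: susp_pt_eq_iff)
  \<comment> \<open>Height and base point are renormalized by one fixed integer, so that the lift
    starts exactly at \<open>(x, r)\<close>.\<close>
  define \<rho> where "\<rho> t = \<rho>' t - of_int k" for t
  define X where "X t = int_iter f k (x' t)" for t
  have cont_\<rho>: "continuous_on UNIV \<rho>" unfolding \<rho>_def by (intro continuous_intros cont')
  have lift: "\<phi> t p = susp_pt f (X t) (\<rho> t)" for t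
    by (simp add: x' X_def \<rho>_def susp_pt_shift)
  have local: "\<exists>\<delta>>0. \<forall>t\<in>ball t0 \<delta>. X t = X t0 \<and> (\<rho> has_real_derivative \<alpha> (\<phi> t p)) (at t)" for t0
  proof -
    have "X t0 \<in> (\<Union>(U, \<kappa>)\<in>A. U)" using atlas by (simp add: smooth_atlas_def)
    then obtain U \<kappa> where U: "(U, \<kappa>) \<in> A" "X t0 \<in> U" by auto
    then have "is_chart euclidean (U, \<kappa>)" using atlas by (auto simp: smooth_atlas_def)
    then have "open U" "inj_on \<kappa> U"
      by (auto simp: is_chart_def dest: homeomorphic_imp_injective_map)
    define b where "b = \<rho> t0 - 1/2"
    define D where "D = pt ` (U \<times> {b<..<b + 1})"
    define \<mu> where "\<mu> = snd (susp_chart f (U, \<kappa>) b)"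
    have chart: "(D, \<mu>) \<in> susp_atlas f A"
      using U(1) by (force simp: susp_atlas_def D_def \<mu>_def susp_chart_def Let_def)
    have "openin (susp_topology f) D"
      unfolding D_def using \<open>open U\<close> by (intro openin_pt_image open_Times) auto
    then have "open {t. \<phi> t p \<in> D}"
      using openin_continuous_map_preimage[OF continuous_map_orbit[OF p]] by fastforce
    moreover have "open {t. \<rho> t \<in> {b<..<b + 1}}"
      using open_vimage[OF open_greaterThanLessThan cont_\<rho>] by (simp add: vimage_def)
    ultimately have "open ({t. \<phi> t p \<in> D} \<inter> {t. \<rho> t \<in> {b<..<b + 1}})" by blast
    moreover have "t0 \<in> {t. \<phi> t p \<in> D} \<inter> {t. \<rho> t \<in> {b<..<b + 1}}"
      using U by (auto simp: lift D_def b_def)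
    ultimately obtain \<delta> where \<delta>: "\<delta> > 0"
      "ball t0 \<delta> \<subseteq> {t. \<phi> t p \<in> D} \<inter> {t. \<rho> t \<in> {b<..<b + 1}}"
      using openE by blast
    \<comment> \<open>Membership in \<open>D\<close> supplies only some representative. Its height
      and \<open>\<rho> t\<close> lie in the same open interval of length 1, so it is the lifted
      pair itself.\<close>
    have in_chart: "X t \<in> U" "\<rho> t \<in> {b<..<b + 1}" if "t \<in> ball t0 \<delta>" for t
    proof -
      show "\<rho> t \<in> {b<..<b + 1}" using \<delta> that by auto
      have "susp_pt f (X t) (\<rho> t) \<in> D" using \<delta> that by (auto simp flip: lift)
      then obtain y s where "y \<in> U" "s \<in> {b<..<b + 1}" "susp_pt f (X t) (\<rho> t) = susp_pt f y s"
        unfolding D_def by auto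
      moreover from this have "\<bar>\<rho> t - s\<bar> < 1" using \<open>\<rho> t \<in> {b<..<b + 1}\<close> by auto
      ultimately show "X t \<in> U" by (simp add: susp_pt_eq_iff_close)
    qed
    have deriv: "((\<lambda>s. (\<kappa> (X s), \<rho> s)) has_vector_derivative (0, \<alpha> (\<phi> t p))) (at t)"
      if t: "t \<in> ball t0 \<delta>" for t
    proof -
      have "((\<lambda>s. \<mu> (\<phi> s p)) has_vector_derivative
          \<alpha> (\<phi> t p) *\<^sub>R generator (susp_flow f) \<mu> (\<phi> t p)) (at t)"
        using generated p chart \<delta> t unfolding flow_generated_by_def by fastforce
      also have "generator (susp_flow f) \<mu> (\<phi> t p) = (0, 1)"
        using in_chart[OF t] by (simp add: \<mu>_def lift generator_susp_flow)
      finally have "((\<lambda>s. \<mu> (\<phi> s p)) has_vector_derivative (0, \<alpha> (\<phi> t p))) (at t)" by simp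
      then show ?thesis
        by (rule has_vector_derivative_transform_within_open[OF _ open_ball t])
          (use in_chart in \<open>auto simp: \<mu>_def lift susp_chart_coords\<close>)
    qed
    have "((\<lambda>s. \<kappa> (X s)) has_vector_derivative 0) (at t)" if "t \<in> ball t0 \<delta>" for t
      using bounded_linear.has_vector_derivative[OF bounded_linear_fst deriv[OF that]] by simp
    then have "\<kappa> (X t) = \<kappa> (X t0)" if "t \<in> ball t0 \<delta>" for t
      using that \<delta>(1)
      by (intro has_derivative_zero_unique_connected[of "ball t0 \<delta>"])
        (auto simp: has_vector_derivative_def)
    \<comment> \<open>Constancy of the coordinates passes to \<open>X\<close> because
      \<open>\<kappa>\<close> is injective on \<open>U\<close>.\<close>
    then have "X t = X t0" if "t \<in> ball t0 \<delta>" for t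
      using inj_onD[OF \<open>inj_on \<kappa> U\<close> _ in_chart(1)[OF that] \<open>X t0 \<in> U\<close>] that by blast
    moreover have "(\<rho> has_real_derivative \<alpha> (\<phi> t p)) (at t)" if "t \<in> ball t0 \<delta>" for t
      using bounded_linear.has_vector_derivative[OF bounded_linear_snd deriv[OF that]]
      by (simp add: has_real_derivative_iff_has_vector_derivative)
    ultimately show ?thesis using \<delta>(1) by blast
  qed
  have "\<forall>a\<in>UNIV. \<forall>\<^sub>F b in at a. X a = X b"
  proof
    fix a
    obtain \<delta> where "\<delta> > 0" "\<forall>t\<in>ball a \<delta>. X t = X a" using local by blast
    then show "\<forall>\<^sub>F b in at a. X a = X b"
      unfolding eventually_at by (metis dist_commute mem_ball)
  qed
  then have "X 0 = X t" for t by (rule connected_local_const[OF connected_UNIV UNIV_I UNIV_I])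
  then have "X t = x" for t by (metis X_def k(2))
  moreover have "(\<rho> has_real_derivative \<alpha> (\<phi> t p)) (at t)" for t
    using local[of t] by auto
  moreover have "\<rho> 0 = r" by (simp add: \<rho>_def k)
  ultimately show thesis using lift that[of \<rho>] by (simp add: p_def)
qed

section \<open>Separation of periodic orbits\<close>

text \<open>The slope of the lift is the value of \<open>\<alpha>\<close> along the orbit, between 0
  and \<open>K\<close>. The two bounds are stated as monotonicity, which compares the lift directly
  at two times.\<close>

lemma orbit_lift_mono:
  obtains \<rho> where "\<rho> 0 = r" "\<forall>t. \<phi> t (susp_pt f x r) = susp_pt f x (\<rho> t)"
    "mono \<rho>" "mono (\<lambda>t. K * t - \<rho> t)" "continuous_on UNIV \<rho>"
proof -
  obtain \<rho> where \<rho>: "\<rho> 0 = r" "\<And>t. \<phi> t (susp_pt f x r) = susp_pt f x (\<rho> t)"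
    and deriv: "\<And>t. (\<rho> has_real_derivative \<alpha> (\<phi> t (susp_pt f x r))) (at t)"
    using orbit_lift[of r x] by blast
  have deriv_mono: "mono g" if "\<And>u. \<exists>y. (g has_real_derivative y) (at u) \<and> 0 \<le> y" for g :: "real \<Rightarrow> real"
  proof (rule monoI)
    fix s t :: real assume "s \<le> t"
    then show "g s \<le> g t" by (rule DERIV_nonneg_imp_nondecreasing) (rule that)
  qed
  have mono: "mono \<rho>"
    by (rule deriv_mono, rule exI, rule conjI, rule deriv, rule speed_nonneg) simp
  have bound: "mono (\<lambda>t. K * t - \<rho> t)"
  proof (rule deriv_mono)
    fix u
    have "((\<lambda>u. K * u - \<rho> u) has_real_derivative K - \<alpha> (\<phi> u (susp_pt f x r))) (at u)"
      by (auto intro!: derivative_eq_intros deriv)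
    moreover have "0 \<le> K - \<alpha> (\<phi> u (susp_pt f x r))" using speed_le by simp
    ultimately show "\<exists>y. ((\<lambda>u. K * u - \<rho> u) has_real_derivative y) (at u) \<and> 0 \<le> y" by blast
  qed
  have "continuous_on UNIV \<rho>"
    using deriv by (meson DERIV_continuous_on has_field_derivative_at_within)
  with \<rho> mono bound that[of \<rho>] show thesis by simp
qed

section \<open>Periods, orbits and the return to the zero section\<close>

lemma flow_eq_iff:
  assumes "p \<in> susp_space f"
  shows "\<phi> s (\<phi> t p) = \<phi> t p \<longleftrightarrow> \<phi> s p = p"
proof -
  have "\<phi> s (\<phi> t p) = \<phi> t (\<phi> s p)" using assms by (metis flow_add add.commute)
  moreover have "\<phi> (- t) (\<phi> t q) = q" if "q \<in> susp_space f" for q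
    using flow_add[OF that, of "- t" t] that by simp
  ultimately show ?thesis using assms flow_in_space by metis
qed

lemma has_period_flow:
  "p \<in> susp_space f \<Longrightarrow> has_period \<phi> (\<phi> t p) T \<longleftrightarrow> has_period \<phi> p T"
  by (simp add: has_period_def flow_eq_iff)

lemma range_flow:
  assumes "p \<in> susp_space f"
  shows "range (\<lambda>s. \<phi> s (\<phi> t p)) = range (\<lambda>s. \<phi> s p)"
proof -
  have "\<phi> s p = \<phi> (s - t) (\<phi> t p)" for s using flow_add[OF assms, of "s - t" t] by simp
  moreover have "\<phi> s (\<phi> t p) = \<phi> (s + t) p" for s using flow_add[OF assms] by simp
  ultimately show ?thesis by (metis (no_types, lifting) image_subset_iff rangeI subset_antisym)
qed

text \<open>Returning to the starting class changes the height by an integer \<open>n\<close>. If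
  \<open>n\<close> were not positive, monotonicity would make the lift constant on
  \<open>[0, T]\<close>, and the point would already return at \<open>T / 2\<close>, against
  minimality of the period.\<close>

lemma lift_period:
  assumes per: "has_period \<phi> (susp_pt f x r) T" and \<rho>0: "\<rho> 0 = r"
    and lift: "\<forall>t. \<phi> t (susp_pt f x r) = susp_pt f x (\<rho> t)"
    and mono: "mono \<rho>"
  obtains n where "0 < n" "\<rho> T = r + of_int n" "int_iter f n x = x"
proof -
  have T: "0 < T" "susp_pt f x (\<rho> T) = susp_pt f x r" using per by (simp_all add: has_period_def flip: lift[rule_format])
  then obtain n where n: "\<rho> T = r + of_int n" "x = int_iter f n x" by (auto simp: susp_pt_eq_iff)
  have "\<rho> 0 \<le> \<rho> (T / 2)" "\<rho> (T / 2) \<le> \<rho> T" using T by (auto intro: monoD[OF mono])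
  moreover have "\<rho> (T / 2) \<noteq> r"
  proof
    assume "\<rho> (T / 2) = r"
    then have "\<phi> (T / 2) (susp_pt f x r) = susp_pt f x r" by (simp add: lift)
    then show False using per T by (auto simp: has_period_def)
  qed
  ultimately have "0 < n" using n \<rho>0 by simp
  with n that show thesis by metis
qed

text \<open>Over one period the lift climbs from \<open>r\<close> to at least \<open>r + 1\<close>,
  so it takes the integer value \<open>\<lceil>r\<rceil>\<close>, and the orbit point at that time
  is on the zero section. Moving along the orbit changes neither period nor orbit.\<close>

lemma periodic_orbit_meets_section:
  assumes p: "p \<in> susp_space f" and per: "has_period \<phi> p T"
  obtains y where "has_period \<phi> (susp_pt f y 0) T"
    "range (\<lambda>t. \<phi> t (susp_pt f y 0)) = range (\<lambda>t. \<phi> t p)"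
proof -
  obtain x r where xr: "p = susp_pt f x r" using p by (rule susp_space_cases)
  obtain \<rho> where \<rho>: "\<rho> 0 = r" "\<forall>t. \<phi> t (susp_pt f x r) = susp_pt f x (\<rho> t)"
    "mono \<rho>" "continuous_on UNIV \<rho>"
    by (rule orbit_lift_mono[of r x])
  obtain n where n: "0 < n" "\<rho> T = r + of_int n"
    using lift_period[OF per[unfolded xr] \<rho>(1-3)] by metis
  have "\<rho> 0 \<le> \<lceil>r\<rceil>" "\<lceil>r\<rceil> \<le> \<rho> T" using n \<rho>(1) by linarith+
  moreover have "0 \<le> T" using per by (simp add: has_period_def)
  ultimately obtain t where "\<rho> t = \<lceil>r\<rceil>"
    using IVT'[of \<rho> 0 "of_int \<lceil>r\<rceil>" T] continuous_on_subset[OF \<rho>(4)] by blast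
  then have "\<phi> t p = susp_pt f (int_iter f \<lceil>r\<rceil> x) 0" by (simp add: xr \<rho>(2) susp_pt_shift)
  then show thesis using that has_period_flow[OF p] range_flow[OF p] per by metis
qed

section \<open>Sampling orbits at fractional times\<close>

lemma funpow_flow:
  assumes "p \<in> susp_space f"
  shows "(\<phi> t ^^ n) p = \<phi> (real n * t) p"
proof (induction n)
  case (Suc n)
  then show ?case using flow_add[OF assms, of t "real n * t"] by (simp add: distrib_right)
qed (simp add: assms)

text \<open>Division with remainder writes \<open>i\<close> as \<open>q * N + r\<close>. The outer
  join controls the unit time \<open>q\<close> and the inner join the fraction \<open>r / N\<close>,
  so a join for the time-one map also controls every time on the grid of mesh
  \<open>1 / N\<close>.\<close>

lemma cover_join_refined:
  assumes W: "W \<in> cover_join (susp_topology f) (\<phi> 1)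
      (cover_join (susp_topology f) (\<phi> (1 / real N)) \<U> N) m"
    and "0 < N" "i < N * m"
  obtains V where "V \<in> \<U>" "\<And>p. p \<in> W \<Longrightarrow> \<phi> (real i / real N) p \<in> V"
proof -
  define q r where "q = i div N" and "r = i mod N"
  have qr: "i = q * N + r" "q < m" "r < N"
    using assms(2,3) by (simp_all add: q_def r_def less_mult_imp_div_less mult.commute)
  obtain u where u: "\<forall>i<m. u i \<in> cover_join (susp_topology f) (\<phi> (1 / real N)) \<U> N"
    "W = {x \<in> susp_space f. \<forall>i<m. (\<phi> 1 ^^ i) x \<in> u i}"
    using W by (auto simp: cover_join_def)
  then obtain v where v: "\<forall>i<N. v i \<in> \<U>"
    "u q = {x \<in> susp_space f. \<forall>i<N. (\<phi> (1 / real N) ^^ i) x \<in> v i}"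
    using qr(2) by (auto simp: cover_join_def)
  have "\<phi> (real i / real N) p \<in> v r" if "p \<in> W" for p
  proof -
    have p: "p \<in> susp_space f" using that u by simp
    have "(\<phi> (1 / real N) ^^ r) ((\<phi> 1 ^^ q) p) \<in> v r" using that u(2) v(2) qr by auto
    then have "\<phi> (real r / real N + real q) p \<in> v r" using p by (simp add: funpow_flow flow_add)
    moreover have "real r / real N + real q = real i / real N"
      using \<open>0 < N\<close> by (simp add: qr(1) field_simps)
    ultimately show ?thesis by simp
  qed
  with v(1) qr(3) that show thesis by blast
qed

text \<open>Both periods lie within one grid step below the common time \<open>j / N\<close>, where
  the two lifts are compared. There they are too close for the two integer increments to differ, so
  one common period of \<open>f\<close> is enough to check.\<close>

lemma periodic_points_shadow:
  assumes N: "0 < N" "4 * K \<le> real N" and c: "0 < c" and j: "j < N * m"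
    and W: "W \<in> cover_join (susp_topology f) (\<phi> 1) (cover_join (susp_topology f) (\<phi> (1 / real N))
        {tube c z b | z b. 0 \<le> b \<and> b < 1} N) m"
    and xy: "susp_pt f x 0 \<in> W" "susp_pt f y 0 \<in> W"
    and per: "has_period \<phi> (susp_pt f x 0) S" "has_period \<phi> (susp_pt f y 0) T"
    and S: "(real j - 1) / real N \<le> S" "S \<le> real j / real N"
    and T: "(real j - 1) / real N \<le> T" "T \<le> real j / real N"
  shows "dist (int_iter f k x) (int_iter f k y) < c"
proof -
  obtain \<rho> where \<rho>: "\<rho> 0 = 0" "\<forall>t. \<phi> t (susp_pt f x 0) = susp_pt f x (\<rho> t)"
    "mono \<rho>" "mono (\<lambda>t. K * t - \<rho> t)"
    by (rule orbit_lift_mono[of 0 x])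
  obtain \<tau> where \<tau>: "\<tau> 0 = 0" "\<forall>t. \<phi> t (susp_pt f y 0) = susp_pt f y (\<tau> t)"
    "mono \<tau>" "mono (\<lambda>t. K * t - \<tau> t)"
    by (rule orbit_lift_mono[of 0 y])
  \<comment> \<open>The choice \<open>4 * K \<le> N\<close> lets a lift advance by at most 1/4 in a
    grid step.\<close>
  have K: "K * d \<le> 1/4" if "0 \<le> d" "d \<le> 1 / real N" for d
  proof (cases "0 \<le> K")
    case True
    then have "K * d \<le> K * (1 / real N)" using that by (intro mult_left_mono) auto
    also have "\<dots> \<le> 1/4" using N by (simp add: field_simps)
    finally show ?thesis .
  next
    case False
    then have "K * d \<le> 0" using that(1) by (simp add: mult_nonpos_nonneg)
    then show ?thesis by simp
  qed
  have grid: "real i / real N \<le> real (Suc i) / real N"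
      "real (Suc i) / real N - real i / real N \<le> 1 / real N" for i
    using N(1) by (simp_all add: field_simps)
  have quarter_\<rho>: "\<rho> t \<le> \<rho> s + 1/4" if "s \<le> t" "t - s \<le> 1 / real N" for s t
    using monoD[OF \<rho>(4) that(1)] K[of "t - s"] that by (simp add: right_diff_distrib)
  have quarter_\<tau>: "\<tau> t \<le> \<tau> s + 1/4" if "s \<le> t" "t - s \<le> 1 / real N" for s t
    using monoD[OF \<tau>(4) that(1)] K[of "t - s"] that by (simp add: right_diff_distrib)
  note step_\<rho> = monoD[OF \<rho>(3) grid(1)] quarter_\<rho>[OF grid]
  note step_\<tau> = monoD[OF \<tau>(3) grid(1)] quarter_\<tau>[OF grid]
  have in_tube: "\<bar>\<rho> (real i / real N) - \<tau> (real i / real N)\<bar> < 1/8 \<and>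
      dist (int_iter f \<lfloor>\<rho> (real i / real N)\<rfloor> x) (int_iter f \<lfloor>\<rho> (real i / real N)\<rfloor> y) < c"
    if "i < N * m" "\<bar>\<rho> (real i / real N) - \<tau> (real i / real N)\<bar> < 7/8" for i
  proof -
    obtain V where V: "V \<in> {tube c z b | z b. 0 \<le> b \<and> b < 1}"
      "\<And>p. p \<in> W \<Longrightarrow> \<phi> (real i / real N) p \<in> V"
      using cover_join_refined[OF W N(1) \<open>i < N * m\<close>] by blast
    then obtain z b where b: "V = tube c z b" "0 \<le> b" "b < 1" by blast
    have "susp_pt f x (\<rho> (real i / real N)) \<in> tube c z b"
      using V(2)[OF xy(1)] by (simp add: \<rho>(2) b(1))
    moreover have "susp_pt f y (\<tau> (real i / real N)) \<in> tube c z b"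
      using V(2)[OF xy(2)] by (simp add: \<tau>(2) b(1))
    ultimately show ?thesis using tube_coords[OF _ _ b(2,3) that(2)] by blast
  qed
  \<comment> \<open>Both lifts start at 0. In a grid step a gap below 1/8 grows to less than 3/8,
    within the 7/8 allowed by \<open>in_tube\<close>, and the common tube brings it back below
    1/8.\<close>
  have close: "\<bar>\<rho> (real i / real N) - \<tau> (real i / real N)\<bar> < 1/8 \<and>
      dist (int_iter f \<lfloor>\<rho> (real i / real N)\<rfloor> x) (int_iter f \<lfloor>\<rho> (real i / real N)\<rfloor> y) < c"
    if "i < N * m" for i
    using that
  proof (induction i)
    case 0
    then show ?case using in_tube[of 0] by (simp add: \<rho>(1) \<tau>(1))
  next
    case (Suc i)
    then have "\<bar>\<rho> (real i / real N) - \<tau> (real i / real N)\<bar> < 1/8" by simp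
    then have "\<bar>\<rho> (real (Suc i) / real N) - \<tau> (real (Suc i) / real N)\<bar> < 7/8"
      using step_\<rho>[of i] step_\<tau>[of i] by linarith
    then show ?case using in_tube Suc.prems by blast
  qed
  obtain n where n: "0 < n" "\<rho> S = of_int n" "int_iter f n x = x"
    using lift_period[OF per(1) \<rho>(1-3)] by auto
  obtain n' where n': "0 < n'" "\<tau> T = of_int n'" "int_iter f n' y = y"
    using lift_period[OF per(2) \<tau>(1-3)] by auto
  have gap: "real j / real N - S \<le> 1 / real N" "real j / real N - T \<le> 1 / real N"
    using S T by (simp_all add: diff_divide_distrib)
  note end_\<rho> = monoD[OF \<rho>(3) S(2)] quarter_\<rho>[OF S(2) gap(1)]
  note end_\<tau> = monoD[OF \<tau>(3) T(2)] quarter_\<tau>[OF T(2) gap(2)]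
  \<comment> \<open>At time \<open>j / N\<close> the lifts exceed \<open>n\<close> and
    \<open>n'\<close> by at most 1/4 and differ by less than 1/8.\<close>
  have "\<bar>of_int n - of_int n' :: real\<bar> < 1"
    using end_\<rho> end_\<tau> n(2) n'(2) close[OF j] by linarith
  then have "n' = n" by linarith
  have visits: "dist (int_iter f k x) (int_iter f k y) < c" if "0 \<le> k" "k < n" for k
  proof -
    \<comment> \<open>At the first grid time when the lift has reached \<open>k\<close>, it has
      overshot by at most 1/4, so its floor is exactly \<open>k\<close>.\<close>
    define i where "i = (LEAST i. of_int k \<le> \<rho> (real i / real N))"
    have reached: "of_int k \<le> \<rho> (real j / real N)" using that(2) end_\<rho>(1) n(2) by simp
    then have i: "of_int k \<le> \<rho> (real i / real N)" "i \<le> j"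
      unfolding i_def by (rule LeastI, rule Least_le)
    have "\<lfloor>\<rho> (real i / real N)\<rfloor> = k"
    proof (cases i)
      case 0
      then show ?thesis using i(1) that(1) by (simp add: \<rho>(1))
    next
      case (Suc l)
      then have "\<not> of_int k \<le> \<rho> (real l / real N)" unfolding i_def by (intro not_less_Least) simp
      then have "\<rho> (real i / real N) < of_int k + 1" using step_\<rho>(2)[of l] Suc by simp
      with i(1) show ?thesis by (simp add: floor_eq_iff)
    qed
    then show ?thesis using close[of i] i(2) j by auto
  qed
  have "dist (int_iter f (k mod n) x) (int_iter f (k mod n) y) < c"
    using n(1) by (intro visits) auto
  then show ?thesis using n(3) n'(3) \<open>n' = n\<close> by (simp add: int_iter_mod)
qed

text \<open>Each periodic orbit is represented by a point of the zero section, sorted by the window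
  of length \<open>1 / N\<close> containing its period. By shadowing and expansiveness, a member of
  the join contains at most one point from each window, and there are \<open>N * m\<close>
  windows.\<close>

lemma periodic_orbits_le:
  assumes compact: "compact (UNIV :: 'm set)"
    and N: "0 < N" "4 * K \<le> real N" and c: "0 < c"
    and expansive: "\<And>x y. \<forall>k. dist (int_iter f k x) (int_iter f k y) < c \<Longrightarrow> x = y"
    and T: "0 < T"
  defines "\<U> \<equiv> cover_join (susp_topology f) (\<phi> (1 / real N)) {tube c z b | z b. 0 \<le> b \<and> b < 1} N"
    and "m \<equiv> nat \<lfloor>T\<rfloor> + 2"
  shows "finite (periodic_orbits (susp_space f) \<phi> T)"
    "card (periodic_orbits (susp_space f) \<phi> T)
      \<le> N * m * min_subcover (susp_topology f) (cover_join (susp_topology f) (\<phi> 1) \<U> m)"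
proof -
  let ?X = "susp_topology f"
  define \<W> where "\<W> = cover_join ?X (\<phi> 1) \<U> m"
  have \<W>: "open_cover ?X \<W>"
    unfolding \<W>_def \<U>_def
    by (intro open_cover_cover_join continuous_map_flow_time open_cover_tubes c)
  define S where "S j = {susp_pt f y 0 | y. \<exists>\<pi>. has_period \<phi> (susp_pt f y 0) \<pi> \<and>
      (real j - 1) / real N \<le> \<pi> \<and> \<pi> \<le> real j / real N}" for j :: nat
  have S: "finite (S j)" "card (S j) \<le> min_subcover ?X \<W>" if j: "j < N * m" for j
  proof -
    have "p = q" if W: "W \<in> \<W>" and pq: "p \<in> W" "q \<in> W" "p \<in> S j" "q \<in> S j" for W p q
    proof -
      obtain x \<pi> where x: "p = susp_pt f x 0" "has_period \<phi> (susp_pt f x 0) \<pi>"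
        "(real j - 1) / real N \<le> \<pi>" "\<pi> \<le> real j / real N"
        using pq(3) unfolding S_def by blast
      obtain y \<pi>' where y: "q = susp_pt f y 0" "has_period \<phi> (susp_pt f y 0) \<pi>'"
        "(real j - 1) / real N \<le> \<pi>'" "\<pi>' \<le> real j / real N"
        using pq(4) unfolding S_def by blast
      have "dist (int_iter f k x) (int_iter f k y) < c" for k
        using periodic_points_shadow[OF N c j W[unfolded \<W>_def \<U>_def] pq(1)[unfolded x(1)]
            pq(2)[unfolded y(1)] x(2) y(2) x(3,4) y(3,4)] .
      then show "p = q" using expansive x(1) y(1) by metis
    qed
    moreover have "S j \<subseteq> topspace ?X" by (auto simp: S_def)
    ultimately show "finite (S j)" "card (S j) \<le> min_subcover ?X \<W>"
      using card_le_min_subcover[OF compact_space_susp[OF compact] \<W>] by metis+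
  qed
  define orb where "orb p = range (\<lambda>t. \<phi> t p)" for p
  have sub: "periodic_orbits (susp_space f) \<phi> T \<subseteq> orb ` (\<Union>j<N * m. S j)"
  proof
    fix \<gamma> assume "\<gamma> \<in> periodic_orbits (susp_space f) \<phi> T"
    then obtain p \<pi> where p: "\<gamma> = orb p" "p \<in> susp_space f" "has_period \<phi> p \<pi>" "\<pi> \<le> T"
      by (auto simp: periodic_orbits_def orb_def)
    then obtain y where y: "has_period \<phi> (susp_pt f y 0) \<pi>" "orb (susp_pt f y 0) = \<gamma>"
      using periodic_orbit_meets_section unfolding orb_def by metis
    \<comment> \<open>Rounding up puts \<open>\<pi>\<close> in the window ending at
      \<open>j / N\<close>.\<close>
    define j where "j = nat \<lceil>real N * \<pi>\<rceil>"
    have "0 < \<pi>" using p(3) by (simp add: has_period_def)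
    then have "0 \<le> real N * \<pi>" by simp
    then have j: "real j - 1 \<le> real N * \<pi>" "real N * \<pi> \<le> real j" "real j < real N * \<pi> + 1"
      unfolding j_def by linarith+
    \<comment> \<open>The summand 2 in \<open>m\<close> leaves a full unit of time beyond
      \<open>T\<close>, so that \<open>j\<close> stays strictly below \<open>N * m\<close>.\<close>
    have "T + 1 \<le> real m" unfolding m_def using T by linarith
    then have "real N * \<pi> + 1 \<le> real N * (real m - 1) + real N"
      using N(1) p(4) by (intro add_mono mult_left_mono) auto
    then have "real j < real (N * m)" using j(3) by (simp add: algebra_simps)
    then have "j < N * m" by (simp only: of_nat_less_iff)
    moreover have "susp_pt f y 0 \<in> S j"
      using y(1) j(1,2) N(1) unfolding S_def by (auto simp: field_simps intro!: exI[of _ \<pi>])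
    ultimately show "\<gamma> \<in> orb ` (\<Union>j<N * m. S j)" using y(2) by blast
  qed
  have fin: "finite (\<Union>j<N * m. S j)" using S(1) by simp
  with sub show "finite (periodic_orbits (susp_space f) \<phi> T)" by (meson finite_imageI finite_subset)
  have "card (periodic_orbits (susp_space f) \<phi> T) \<le> card (orb ` (\<Union>j<N * m. S j))"
    using sub fin by (intro card_mono) auto
  also have "\<dots> \<le> card (\<Union>j<N * m. S j)" by (rule card_image_le[OF fin])
  also have "\<dots> \<le> (\<Sum>j<N * m. card (S j))" by (rule card_UN_le) simp
  also have "\<dots> \<le> (\<Sum>j<N * m. min_subcover ?X \<W>)" using S(2) by (intro sum_mono) simp
  finally show "card (periodic_orbits (susp_space f) \<phi> T) \<le> N * m * min_subcover ?X (cover_join ?X (\<phi> 1) \<U> m)"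
    by (simp add: \<W>_def)
qed

section \<open>From the orbit count to entropy\<close>

lemma periodic_orbit_growth_le_entropy:
  assumes compact: "compact (UNIV :: 'm set)" and "expansive f"
  shows "Limsup at_top (\<lambda>T. ereal (1 / T) * log_card (periodic_orbits (susp_space f) \<phi> T))
    \<le> topological_entropy (susp_topology f) (\<phi> 1)"
proof -
  let ?X = "susp_topology f"
  obtain c where c: "0 < c" "\<And>x y. \<forall>k. dist (int_iter f k x) (int_iter f k y) < c \<Longrightarrow> x = y"
    using \<open>expansive f\<close> unfolding expansive_def by blast
  define N where "N = nat \<lceil>4 * K\<rceil> + 1"
  have N: "0 < N" "4 * K \<le> real N" unfolding N_def by linarith+
  \<comment> \<open>This cover depends on \<open>c\<close> and \<open>N\<close> but not on
    \<open>T\<close>, so its entropy under \<open>\<phi> 1\<close> is one of the terms in the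
    supremum defining topological entropy.\<close>
  define \<U> where "\<U> = cover_join ?X (\<phi> (1 / real N)) {tube c z b | z b. 0 \<le> b \<and> b < 1} N"
  define s where "s n = min_subcover ?X (cover_join ?X (\<phi> 1) \<U> n)" for n
  have \<U>: "open_cover ?X \<U>"
    unfolding \<U>_def by (intro open_cover_cover_join continuous_map_flow_time open_cover_tubes c)
  have "susp_space f \<noteq> {}" by (metis susp_pt_in_space empty_iff)
  then have pos: "0 < s n" for n
    unfolding s_def
    by (intro min_subcover_pos compact_space_susp compact open_cover_cover_join
        continuous_map_flow_time \<U>) simp
  have "Limsup at_top (\<lambda>T. ereal (1 / T) * log_card (periodic_orbits (susp_space f) \<phi> T))
      \<le> limsup (\<lambda>n. ereal (ln (real (s n)) / real n))"
  proof (rule Limsup_log_growth_le[OF _ pos])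
    show "0 < real N" using N by simp
    fix T :: real assume "0 < T"
    define P where "P = periodic_orbits (susp_space f) \<phi> T"
    define m where "m = nat \<lfloor>T\<rfloor> + 2"
    have P: "finite P" "card P \<le> N * m * s m"
      using periodic_orbits_le[OF compact N c \<open>0 < T\<close>] unfolding P_def m_def s_def \<U>_def by auto
    have "ln (real (card P)) \<le> ln (real N * real m * real (s m))" if "P \<noteq> {}"
    proof -
      have "0 < card P" using that P(1) by (simp add: card_gt_0_iff)
      moreover have "real (card P) \<le> real N * real m * real (s m)"
        using P(2) by (metis of_nat_le_iff of_nat_mult)
      ultimately show ?thesis by simp
    qed
    then show "log_card P \<le> ereal (ln (real N * real m * real (s m)))"
      using P(1) by (simp add: log_card_def)
  qed
  also have "\<dots> = cover_entropy ?X (\<phi> 1) \<U>" by (simp add: cover_entropy_def s_def)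
  also have "\<dots> \<le> topological_entropy ?X (\<phi> 1)"
    unfolding topological_entropy_def using \<U> by (intro SUP_upper) simp
  finally show ?thesis .
qed

end

theorem corollary5p4:
  fixes A :: "('m::metric_space, 'e::real_normed_vector) chart set"
    and f :: "'m \<Rightarrow> 'm"
    and \<phi> :: "real \<Rightarrow> ('m \<times> real) set \<Rightarrow> ('m \<times> real) set"
  assumes "compact (UNIV :: 'm set)"
    and "smooth_manifold euclidean A"
    and "diffeomorphism euclidean A euclidean A f"
    and "expansive f"
    and "singular_suspension f A \<phi>"
  shows "Limsup at_top (\<lambda>T::real. ereal (1 / T) * log_card (periodic_orbits (susp_space f) \<phi> T))
    \<le> topological_entropy (susp_topology f) (\<phi> 1)"
proof -
  interpret suspension f
    using assms(3) by unfold_locales (auto simp: diffeomorphism_def smooth_map_def)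
  obtain \<sigma> \<alpha> where brake: "brake_function f A \<sigma> \<alpha>"
    and generated: "flow_generated_by (susp_topology f) (susp_atlas f A) \<phi>
          (\<lambda>\<kappa> p. \<alpha> p *\<^sub>R generator (susp_flow f) \<kappa> p)"
    using assms(5) unfolding singular_suspension_def by blast
  \<comment> \<open>Continuity of the brake function on the compact suspension yields the speed
    bound \<open>K\<close>.\<close>
  have "continuous_map (susp_topology f) euclideanreal \<alpha>"
    using brake by (simp add: brake_function_def smooth_map_def)
  moreover have "compactin (susp_topology f) (susp_space f)"
    using compact_space_susp[OF assms(1)] by (simp add: compact_space_def)
  ultimately have "compactin euclideanreal (\<alpha> ` susp_space f)" by (intro image_compactin)
  then have "bounded (\<alpha> ` susp_space f)" by (simp add: compact_imp_bounded)
  then obtain K where "\<forall>p\<in>susp_space f. norm (\<alpha> p) \<le> K" unfolding bounded_iff by auto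
  then have K: "p \<in> susp_space f \<Longrightarrow> \<alpha> p \<le> K" for p by fastforce
  interpret suspension_time_change f A \<phi> \<alpha> K
    using assms(2) generated brake K
    by unfold_locales (simp_all add: smooth_manifold_def brake_function_def)
  show ?thesis using assms(1,4) by (rule periodic_orbit_growth_le_entropy)
qed

end
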